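(* If $0<\sigma<1$ then $$\{\lambda\in\mathbf{C}:|\lambda|\le 1\}\setminus H_\sigma\subseteq S_\sigma .$$
   Context: Let $\Omega_\sigma=\{\pm\sigma\}^{\mathbf{Z}}$. For $c\in\Omega_\sigma$, $A_c$ is the bounded operator on $\ell^2(\mathbf{Z})$ given by $(A_cf)_n=c_nf_{n-1}+f_{n+1}$, and $\mathrm{Spec}(A_c)$ is its spectrum. A sequence $c\in\Omega_\sigma$ is pseudo-ergodic if for every finite sequence $b:\{1,\dots,n\}\to\{\pm\sigma\}$ there exists $m\in\mathbf{Z}$ with $b_r=c_{m+r}$ for all $r\in\{1,\dots,n\}$. It is known that $\mathrm{Spec}(A_c)$ is the same set for all pseudo-ergodic $c\in\Omega_\sigma$; this common set is denoted $S_\sigma$. (It is also known that $S_\sigma=\bigcup_{b\in\Omega_\sigma}\mathrm{Spec}(A_b)$.) Define $$E_\sigma=\Big\{x+iy:\tfrac{x^2}{(1+\sigma)^2}+\tfrac{y^2}{(1-\sigma)^2}<1\Big\},\qquad E_{-\sigma}=\Big\{x+iy:\tfrac{x^2}{(1-\sigma)^2}+\tfrac{y^2}{(1+\sigma)^2}<1\Big\}$$ ($x,y\in\mathbf{R}$) and $H_\sigma=E_\sigma\cap E_{-\sigma}$. *)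

theory Defs
  imports "HOL-Analysis.Analysis"
begin

definition ell2 :: "(int \<Rightarrow> complex) set" where
  "ell2 = {f. (\<lambda>n. (cmod (f n))\<^sup>2) summable_on UNIV}"

definition ell2_norm :: "(int \<Rightarrow> complex) \<Rightarrow> real" where
  "ell2_norm f = sqrt (\<Sum>\<^sub>\<infinity>n. (cmod (f n))\<^sup>2)"

text \<open>Operators are total functions on all sequences; only their action on \<^term>\<open>ell2\<close> matters.\<close>

definition bounded_op :: "((int \<Rightarrow> complex) \<Rightarrow> (int \<Rightarrow> complex)) \<Rightarrow> bool" where
  "bounded_op T \<longleftrightarrow>
     (\<forall>f\<in>ell2. T f \<in> ell2) \<and>
     (\<forall>f\<in>ell2. \<forall>g\<in>ell2. T (\<lambda>n. f n + g n) = (\<lambda>n. T f n + T g n)) \<and>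
     (\<forall>a. \<forall>f\<in>ell2. T (\<lambda>n. a * f n) = (\<lambda>n. a * T f n)) \<and>
     (\<exists>K. \<forall>f\<in>ell2. ell2_norm (T f) \<le> K * ell2_norm f)"

definition Spec :: "((int \<Rightarrow> complex) \<Rightarrow> (int \<Rightarrow> complex)) \<Rightarrow> complex set" where
  "Spec T = {z. \<not> (\<exists>R. bounded_op R \<and>
     (\<forall>f\<in>ell2. R (\<lambda>n. T f n - z * f n) = f \<and> (\<lambda>n. T (R f) n - z * R f n) = f))}"

definition Omega :: "real \<Rightarrow> (int \<Rightarrow> real) set" where
  "Omega \<sigma> = {c. \<forall>n. c n \<in> {\<sigma>, -\<sigma>}}"

definition A_op :: "(int \<Rightarrow> real) \<Rightarrow> (int \<Rightarrow> complex) \<Rightarrow> (int \<Rightarrow> complex)" where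
  "A_op c f = (\<lambda>n. of_real (c n) * f (n - 1) + f (n + 1))"

text \<open>A finite sequence of length \<open>N\<close> is a total function of which only the values
  on \<open>{1..N}\<close> are used.\<close>

definition pseudo_ergodic :: "real \<Rightarrow> (int \<Rightarrow> real) \<Rightarrow> bool" where
  "pseudo_ergodic \<sigma> c \<longleftrightarrow> c \<in> Omega \<sigma> \<and>
     (\<forall>(N::nat) (b :: nat \<Rightarrow> real). (\<forall>r\<in>{1..N}. b r \<in> {\<sigma>, -\<sigma>}) \<longrightarrow>
        (\<exists>m::int. \<forall>r\<in>{1..N}. b r = c (m + int r)))"

text \<open>The common spectrum of all \<^term>\<open>A_op c\<close> with \<open>c\<close> pseudo-ergodic. The description is
  proper because pseudo-ergodic sequences exist and their operators all have the same spectrum.\<close>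

definition S_set :: "real \<Rightarrow> complex set" where
  "S_set \<sigma> = (THE S. \<forall>c. pseudo_ergodic \<sigma> c \<longrightarrow> Spec (A_op c) = S)"

definition E_set :: "real \<Rightarrow> complex set" where
  "E_set \<sigma> = {z. (Re z)\<^sup>2 / (1 + \<sigma>)\<^sup>2 + (Im z)\<^sup>2 / (1 - \<sigma>)\<^sup>2 < 1}"

definition H_set :: "real \<Rightarrow> complex set" where
  "H_set \<sigma> = E_set \<sigma> \<inter> E_set (- \<sigma>)"

end

theory Submission
  imports Defs "HOL-Complex_Analysis.Great_Picard" "HOL-Library.Discrete_Functions"
begin

text \<open>
  By the theory of limit operators, the spectrum of \<^term>\<open>A_op c\<close> for pseudo-ergodic \<open>c\<close>
  contains that of \<^term>\<open>A_op b\<close> for every \<open>b\<close> in \<^term>\<open>Omega \<sigma>\<close>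
  (\<open>Spec_subset_pseudo_ergodic\<close>); in particular it does not depend on \<open>c\<close>, and it is
  \<^term>\<open>S_set \<sigma>\<close>. More precisely, if \<open>z\<close> is not in that spectrum, then one constant bounds
  all the operators \<open>A_op b - z\<close> from below (\<open>uniform_lower_bound\<close>). Hence \<open>z\<close> lies in
  \<^term>\<open>S_set \<sigma>\<close> as soon as there are \<open>\<mu>\<close> arbitrarily close to \<open>z\<close>, each of them an
  eigenvalue of some \<^term>\<open>A_op b\<close> with a square summable eigenvector.

  Such an eigenvector is found for every \<open>\<mu>\<close> with \<open>cmod \<mu> < 1\<close> that lies strictly outside
  one of the two ellipses, of parameter \<open>s = \<sigma>\<close> or \<open>s = - \<sigma>\<close> (\<open>eigenvector\<close>), by gluing
  two half-lines.

  On the left, \<open>b\<close> is the constant \<open>s\<close>. The recurrence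
  \<open>s * f (n - 1) + f (n + 1) = \<mu> * f n\<close> is solved by the powers of any root of
  \<open>z + s / z = \<mu>\<close>, and outside the ellipse one root has modulus larger than one
  (\<open>expanding_root\<close>); its powers decay towards \<open>- \<infinity>\<close>.

  On the right, \<open>b\<close> is chosen such that every solution decays, so that it does not matter
  with which initial values the left half arrives (\<open>half_line_stable_disc\<close>). For
  \<open>cmod \<mu> + \<sigma> < 1\<close> the constant sequence has this property. In general it is pulled back
  through a squaring: the square of \<^term>\<open>A_op c\<close> couples only sites of the same parity, and its
  diagonal entries are \<open>c n + c (n + 1)\<close>. If these vanish for even \<open>n\<close>, then on the even sites
  the square acts as an operator of the same form
  with parameter \<open>\<sigma>\<^sup>2\<close> and coefficients that can be prescribed (\<open>half_line_stable_sqrt\<close>). Since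
  \<open>(\<sigma>, \<mu>)\<close> is thereby reduced to \<open>(\<sigma>\<^sup>2, \<mu>\<^sup>2)\<close>, finitely many steps lead to the case of small
  parameters.

  Finally, every \<open>z\<close> in the closed disc outside the hole is a limit of such \<open>\<mu>\<close>
  (\<open>approximation_outside_ellipse\<close>).
\<close>

section \<open>The space of square summable sequences\<close>

lemma ell2_norm_nonneg: "0 \<le> ell2_norm f"
  by (simp add: ell2_norm_def infsum_nonneg)

lemma L2_set_le_ell2_norm:
  assumes "f \<in> ell2" "finite F"
  shows "L2_set (\<lambda>n. cmod (f n)) F \<le> ell2_norm f"
  unfolding L2_set_def ell2_norm_def
  using assms by (intro real_sqrt_le_mono finite_sum_le_infsum) (auto simp: ell2_def)

lemma cmod_le_ell2_norm: "f \<in> ell2 \<Longrightarrow> cmod (f n) \<le> ell2_norm f"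
  using L2_set_le_ell2_norm[of f "{n}"] by (simp add: L2_set_def)

text \<open>The norm is the supremum of the Euclidean norms over finite sets of sites, so estimates for
  finite sums carry over together with membership.\<close>

lemma ell2_boundedI:
  assumes B: "\<And>F. finite F \<Longrightarrow> L2_set (\<lambda>n. cmod (f n)) F \<le> B"
  shows "f \<in> ell2" and "ell2_norm f \<le> B"
proof -
  have B0: "0 \<le> B" using B[of "{}"] by simp
  have *: "(\<Sum>n\<in>F. (cmod (f n))\<^sup>2) \<le> B\<^sup>2" if "finite F" for F
    using B[OF that] B0 unfolding L2_set_def by (meson real_le_lsqrt real_sqrt_le_iff real_sqrt_unique sqrt_le_D)
  have s: "(\<lambda>n. (cmod (f n))\<^sup>2) summable_on UNIV"
    by (rule nonneg_bdd_above_summable_on) (auto intro!: bdd_aboveI * )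
  then show "f \<in> ell2" by (simp add: ell2_def)
  have "(\<Sum>\<^sub>\<infinity>n. (cmod (f n))\<^sup>2) \<le> B\<^sup>2"
    by (rule infsum_le_finite_sums[OF s]) (use * in auto)
  then show "ell2_norm f \<le> B"
    unfolding ell2_norm_def using B0 by (simp add: real_le_lsqrt)
qed

lemma ell2_add:
  assumes "f \<in> ell2" "g \<in> ell2"
  shows "(\<lambda>n. f n + g n) \<in> ell2" and "ell2_norm (\<lambda>n. f n + g n) \<le> ell2_norm f + ell2_norm g"
proof -
  have *: "L2_set (\<lambda>n. cmod (f n + g n)) F \<le> ell2_norm f + ell2_norm g" if "finite F" for F
  proof -
    have "L2_set (\<lambda>n. cmod (f n + g n)) F \<le> L2_set (\<lambda>n. cmod (f n) + cmod (g n)) F"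
      by (intro L2_set_mono norm_triangle_ineq) auto
    also have "\<dots> \<le> L2_set (\<lambda>n. cmod (f n)) F + L2_set (\<lambda>n. cmod (g n)) F"
      by (rule L2_set_triangle_ineq)
    also have "\<dots> \<le> ell2_norm f + ell2_norm g"
      by (intro add_mono L2_set_le_ell2_norm assms that)
    finally show ?thesis .
  qed
  show "(\<lambda>n. f n + g n) \<in> ell2" by (rule ell2_boundedI(1)) (rule * )
  show "ell2_norm (\<lambda>n. f n + g n) \<le> ell2_norm f + ell2_norm g" by (rule ell2_boundedI(2)) (rule * )
qed

lemma ell2_dominated:
  assumes "f \<in> ell2" and C: "\<And>n. cmod (g n) \<le> C * cmod (f n)" and "0 \<le> C"
  shows "g \<in> ell2" and "ell2_norm g \<le> C * ell2_norm f"
proof -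
  have *: "L2_set (\<lambda>n. cmod (g n)) F \<le> C * ell2_norm f" if "finite F" for F
  proof -
    have "L2_set (\<lambda>n. cmod (g n)) F \<le> L2_set (\<lambda>n. C * cmod (f n)) F"
      by (intro L2_set_mono C) auto
    also have "\<dots> = C * L2_set (\<lambda>n. cmod (f n)) F"
      using \<open>0 \<le> C\<close> by (simp add: L2_set_right_distrib)
    also have "\<dots> \<le> C * ell2_norm f"
      by (intro mult_left_mono L2_set_le_ell2_norm assms that)
    finally show ?thesis .
  qed
  show "g \<in> ell2" by (rule ell2_boundedI(1)) (rule * )
  show "ell2_norm g \<le> C * ell2_norm f" by (rule ell2_boundedI(2)) (rule * )
qed

lemma ell2_scale:
  assumes "f \<in> ell2"
  shows "(\<lambda>n. a * f n) \<in> ell2" and "ell2_norm (\<lambda>n. a * f n) \<le> cmod a * ell2_norm f"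
  using ell2_dominated[OF assms, of "\<lambda>n. a * f n" "cmod a"] by (auto simp: norm_mult)

lemma ell2_diff:
  assumes "f \<in> ell2" "g \<in> ell2"
  shows "(\<lambda>n. f n - g n) \<in> ell2"
  using ell2_add(1)[OF assms(1) ell2_scale(1)[OF assms(2), of "-1"]] by simp

lemma bij_translate: "bij_betw (\<lambda>n::int. n + m) UNIV UNIV"
  by (rule bij_betwI[of _ _ _ "\<lambda>n. n - m"]) auto

lemma ell2_shift: "(\<lambda>n. f (n + m)) \<in> ell2 \<longleftrightarrow> f \<in> ell2"
  unfolding ell2_def
  using summable_on_reindex_bij_betw[OF bij_translate, of "\<lambda>n. (cmod (f n))\<^sup>2" m] by simp

lemma ell2_norm_shift: "ell2_norm (\<lambda>n. f (n + m)) = ell2_norm f"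
  unfolding ell2_norm_def
  using infsum_reindex_bij_betw[OF bij_translate, of "\<lambda>n. (cmod (f n))\<^sup>2" m] by simp

lemma ell2_tail:
  assumes f: "f \<in> ell2" and e: "0 < e"
  shows "\<exists>M. ell2_norm (\<lambda>n. if \<bar>n\<bar> \<le> int M then 0 else f n) \<le> e"
proof -
  let ?q = "\<lambda>n. (cmod (f n))\<^sup>2"
  have s: "?q summable_on UNIV" using f by (simp add: ell2_def)
  obtain F where F: "finite F" "dist (sum ?q F) (infsum ?q UNIV) \<le> e\<^sup>2"
    using infsum_finite_approximation[OF s, of "e\<^sup>2"] e by auto
  define M where "M = nat (Max (insert 0 (abs ` F)))"
  have FM: "\<bar>n\<bar> \<le> int M" if "n \<in> F" for n
  proof -
    have "\<bar>n\<bar> \<le> Max (insert 0 (abs ` F))" using that F(1) by (intro Max_ge) auto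
    then show ?thesis unfolding M_def by linarith
  qed
  have "L2_set (\<lambda>n. cmod (if \<bar>n\<bar> \<le> int M then 0 else f n)) G \<le> e" if G: "finite G" for G
  proof -
    let ?G = "{n\<in>G. \<not> \<bar>n\<bar> \<le> int M}"
    have "(\<Sum>n\<in>G. (cmod (if \<bar>n\<bar> \<le> int M then 0 else f n))\<^sup>2) = sum ?q ?G"
      using G by (intro sum.mono_neutral_cong_right) auto
    moreover have "sum ?q ?G + sum ?q F = sum ?q (?G \<union> F)"
      by (subst sum.union_disjoint) (use G F(1) FM in auto)
    moreover have "sum ?q (?G \<union> F) \<le> infsum ?q UNIV"
      by (rule finite_sum_le_infsum[OF s]) (use G F(1) in auto)
    ultimately have "(\<Sum>n\<in>G. (cmod (if \<bar>n\<bar> \<le> int M then 0 else f n))\<^sup>2) \<le> e\<^sup>2"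
      using F(2) by (auto simp: dist_real_def)
    then show ?thesis unfolding L2_set_def using e by (simp add: real_le_lsqrt)
  qed
  then show ?thesis by (intro exI[of _ M] ell2_boundedI(2))
qed

section \<open>Pseudo-ergodic sequences and limit operators\<close>

definition pencil :: "(int \<Rightarrow> real) \<Rightarrow> complex \<Rightarrow> (int \<Rightarrow> complex) \<Rightarrow> int \<Rightarrow> complex" where
  "pencil c z f = (\<lambda>n. A_op c f n - z * f n)"

lemma pencil_translate:
  "pencil (\<lambda>n. c (n + m)) z (\<lambda>n. f (n + m)) = (\<lambda>n. pencil c z f (n + m))"
  by (simp add: pencil_def A_op_def fun_eq_iff algebra_simps)

lemma pencil_add: "pencil c z (\<lambda>n. f n + g n) = (\<lambda>n. pencil c z f n + pencil c z g n)"
  by (simp add: pencil_def A_op_def fun_eq_iff algebra_simps)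

lemma pencil_diff: "pencil c z (\<lambda>n. f n - g n) = (\<lambda>n. pencil c z f n - pencil c z g n)"
  by (simp add: pencil_def A_op_def fun_eq_iff algebra_simps)

lemma pencil_scale: "pencil c z (\<lambda>n. a * f n) = (\<lambda>n. a * pencil c z f n)"
  by (simp add: pencil_def A_op_def fun_eq_iff algebra_simps)

lemma Omega_cmod: "c \<in> Omega \<sigma> \<Longrightarrow> cmod (of_real (c n)) = \<bar>\<sigma>\<bar>"
  by (auto simp: Omega_def dest!: spec[of _ n])

lemma pencil_ell2:
  assumes "c \<in> Omega \<sigma>" "f \<in> ell2"
  shows "pencil c z f \<in> ell2"
proof -
  have "(\<lambda>n. f (n - 1)) \<in> ell2" using ell2_shift[of f "-1"] assms by simp
  then have "(\<lambda>n. of_real (c n) * f (n - 1)) \<in> ell2"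
    by (rule ell2_dominated(1)[where C = "\<bar>\<sigma>\<bar>"]) (auto simp: norm_mult Omega_cmod[OF assms(1)] simp del: norm_of_real)
  moreover have "(\<lambda>n. f (n + 1)) \<in> ell2" using ell2_shift[of f 1] assms by simp
  ultimately show ?thesis
    unfolding pencil_def A_op_def by (intro ell2_diff ell2_add ell2_scale assms)
qed

lemma pseudo_ergodic_window:
  assumes c: "pseudo_ergodic \<sigma> c" and b: "b \<in> Omega \<sigma>"
  shows "\<exists>m. \<forall>n. \<bar>n\<bar> \<le> int M \<longrightarrow> c (n + m) = b n"
proof -
  have "\<exists>m. \<forall>r\<in>{1..2 * M + 1}. b (int r - int M - 1) = c (m + int r)"
    using c b unfolding pseudo_ergodic_def Omega_def by auto
  then obtain m where m: "\<And>r. r \<in> {1..2 * M + 1} \<Longrightarrow> b (int r - int M - 1) = c (m + int r)"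
    by blast
  have "c (n + (m + int M + 1)) = b n" if "\<bar>n\<bar> \<le> int M" for n
  proof -
    have "nat (n + int M + 1) \<in> {1..2 * M + 1}" using that by auto
    from m[OF this] that show ?thesis by (simp add: algebra_simps)
  qed
  then show ?thesis by blast
qed

text \<open>Suitable translates of \<open>A_op c\<close> converge strongly to \<open>A_op b\<close>: on a large window the
  coefficients agree, and outside it \<open>f\<close> has small norm.\<close>

lemma limit_operator:
  assumes c: "pseudo_ergodic \<sigma> c" and b: "b \<in> Omega \<sigma>" and f: "f \<in> ell2" and e: "0 < e"
  shows "\<exists>m. ell2_norm (\<lambda>n. pencil (\<lambda>n. c (n + m)) z f n - pencil b z f n) \<le> e"
proof -
  have f1: "(\<lambda>n. f (n - 1)) \<in> ell2" using ell2_shift[of f "-1"] f by simp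
  define d where "d = e / (2 * \<bar>\<sigma>\<bar> + 1)"
  have d: "0 < d" "2 * \<bar>\<sigma>\<bar> * d \<le> e"
    using e by (auto simp: d_def field_simps add_pos_nonneg)
  obtain M where M: "ell2_norm (\<lambda>n. if \<bar>n\<bar> \<le> int M then 0 else f (n - 1)) \<le> d"
    using ell2_tail[OF f1 d(1)] by auto
  obtain m where m: "\<And>n. \<bar>n\<bar> \<le> int M \<Longrightarrow> c (n + m) = b n"
    using pseudo_ergodic_window[OF c b] by blast
  let ?t = "\<lambda>n. if \<bar>n\<bar> \<le> int M then 0 else f (n - 1)"
  have t: "?t \<in> ell2" by (rule ell2_dominated(1)[OF f1, where C = 1]) auto
  have "c \<in> Omega \<sigma>" using c by (simp add: pseudo_ergodic_def)
  then have cb: "\<bar>c n - b k\<bar> \<le> 2 * \<bar>\<sigma>\<bar>" for n k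
    using Omega_cmod[of c \<sigma> n] Omega_cmod[OF b, of k] by simp
  have bd: "cmod (pencil (\<lambda>n. c (n + m)) z f n - pencil b z f n) \<le> 2 * \<bar>\<sigma>\<bar> * cmod (?t n)" for n
  proof -
    have "pencil (\<lambda>n. c (n + m)) z f n - pencil b z f n = of_real (c (n + m) - b n) * f (n - 1)"
      by (simp add: pencil_def A_op_def algebra_simps)
    then have "cmod (pencil (\<lambda>n. c (n + m)) z f n - pencil b z f n) = \<bar>c (n + m) - b n\<bar> * cmod (f (n - 1))"
      by (simp only: norm_mult norm_of_real)
    also have "\<dots> \<le> 2 * \<bar>\<sigma>\<bar> * cmod (?t n)"
      using m[of n] mult_right_mono[OF cb[of "n + m" n], of "cmod (f (n - 1))"] by auto
    finally show ?thesis .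
  qed
  have "ell2_norm (\<lambda>n. pencil (\<lambda>n. c (n + m)) z f n - pencil b z f n) \<le> 2 * \<bar>\<sigma>\<bar> * ell2_norm ?t"
    by (rule ell2_dominated(2)[OF t bd]) simp
  also have "\<dots> \<le> 2 * \<bar>\<sigma>\<bar> * d" using M by (intro mult_left_mono) auto
  finally show ?thesis using d by (meson order_trans)
qed

lemma resolvent_exists:
  assumes "z \<notin> Spec (A_op c)"
  shows "\<exists>R K. bounded_op R \<and> 0 \<le> K \<and> (\<forall>f\<in>ell2. R (pencil c z f) = f \<and> pencil c z (R f) = f \<and>
    ell2_norm (R f) \<le> K * ell2_norm f)"
proof -
  have "\<exists>R. bounded_op R \<and> (\<forall>f\<in>ell2. R (pencil c z f) = f \<and> pencil c z (R f) = f)"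
    using assms by (simp add: Spec_def pencil_def)
  then obtain R where R: "bounded_op R" "\<forall>f\<in>ell2. R (pencil c z f) = f \<and> pencil c z (R f) = f"
    by auto
  have "\<exists>K. \<forall>f\<in>ell2. ell2_norm (R f) \<le> K * ell2_norm f"
    using R(1) by (simp add: bounded_op_def)
  then obtain K where K: "\<And>f. f \<in> ell2 \<Longrightarrow> ell2_norm (R f) \<le> K * ell2_norm f"
    by auto
  have "ell2_norm (R f) \<le> max K 0 * ell2_norm f" if "f \<in> ell2" for f
    using K[OF that] mult_right_mono[OF max.cobounded1 ell2_norm_nonneg, of K f 0] by linarith
  with R show ?thesis by (intro exI[of _ R] exI[of _ "max K 0"]) simp
qed

text \<open>The norm of the resolvent of \<open>A_op c\<close> gives a lower bound for all translates at once, and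
  lower bounds survive strong limits. That the constant is the same for all \<open>b\<close> takes the place of
  the closedness of the spectrum in the final approximation argument.\<close>

lemma uniform_lower_bound:
  assumes c: "pseudo_ergodic \<sigma> c" and z: "z \<notin> Spec (A_op c)"
  shows "\<exists>K\<ge>0. \<forall>b\<in>Omega \<sigma>. \<forall>f\<in>ell2. ell2_norm f \<le> K * ell2_norm (pencil b z f)"
proof -
  obtain R K where RK: "bounded_op R \<and> 0 \<le> K \<and> (\<forall>f\<in>ell2. R (pencil c z f) = f \<and> pencil c z (R f) = f \<and>
    ell2_norm (R f) \<le> K * ell2_norm f)"
    using resolvent_exists[OF z] by (elim exE)
  then have R: "0 \<le> K" "\<And>f. f \<in> ell2 \<Longrightarrow> R (pencil c z f) = f"
    and R3: "\<And>f. f \<in> ell2 \<Longrightarrow> ell2_norm (R f) \<le> K * ell2_norm f"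
    by simp_all
  have co: "c \<in> Omega \<sigma>" using c by (simp add: pseudo_ergodic_def)
  have "ell2_norm f \<le> K * ell2_norm (pencil b z f)" if b: "b \<in> Omega \<sigma>" and f: "f \<in> ell2" for b f
  proof (rule field_le_epsilon)
    fix e :: real assume e: "0 < e"
    then have "0 < e / (K + 1)" using R(1) by simp
    then obtain m where m: "ell2_norm (\<lambda>n. pencil (\<lambda>n. c (n + m)) z f n - pencil b z f n) \<le> e / (K + 1)"
      using limit_operator[OF c b f] by blast
    define g where "g = (\<lambda>n. f (n - m))"
    have fg: "f = (\<lambda>n. g (n + m))" by (simp add: g_def)
    have g: "g \<in> ell2" using ell2_shift[of f "-m"] f by (simp add: g_def)
    have cm: "(\<lambda>n. c (n + m)) \<in> Omega \<sigma>" using co by (simp add: Omega_def)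
    have "ell2_norm f = ell2_norm (R (pencil c z g))"
      using ell2_norm_shift[of f "-m"] R(2)[OF g] by (simp add: g_def)
    also have "\<dots> \<le> K * ell2_norm (pencil c z g)"
      by (intro R3 pencil_ell2[OF co] g)
    also have "ell2_norm (pencil c z g) = ell2_norm (pencil (\<lambda>n. c (n + m)) z f)"
      using ell2_norm_shift[of "pencil c z g" m] pencil_translate[of c m z g] by (simp add: fg)
    also have "\<dots> = ell2_norm (\<lambda>n. pencil b z f n + (pencil (\<lambda>n. c (n + m)) z f n - pencil b z f n))"
      by simp
    also have "\<dots> \<le> ell2_norm (pencil b z f) + ell2_norm (\<lambda>n. pencil (\<lambda>n. c (n + m)) z f n - pencil b z f n)"
      by (intro ell2_add ell2_diff pencil_ell2[OF b] pencil_ell2[OF cm] f)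
    also have "\<dots> \<le> ell2_norm (pencil b z f) + e / (K + 1)" using m by simp
    finally have "ell2_norm f \<le> K * (ell2_norm (pencil b z f) + e / (K + 1))"
      using R(1) by (simp add: mult_left_mono)
    also have "\<dots> \<le> K * ell2_norm (pencil b z f) + e"
      using R(1) e by (simp add: field_simps)
    finally show "ell2_norm f \<le> K * ell2_norm (pencil b z f) + e" .
  qed
  with R(1) show ?thesis by (intro exI[of _ K]) simp
qed

text \<open>Surjectivity also passes to the limit, by weak compactness: the equation is solved for
  translates that agree with \<open>b\<close> on growing windows. The solutions are bounded, hence have a
  subsequence that converges at each site, and at a given site the equation for \<open>b\<close> eventually
  holds along it.\<close>

lemma pencil_solvable:
  assumes c: "pseudo_ergodic \<sigma> c" and z: "z \<notin> Spec (A_op c)"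
    and b: "b \<in> Omega \<sigma>" and g: "g \<in> ell2"
  shows "\<exists>f\<in>ell2. pencil b z f = g"
proof -
  obtain R K where RK: "bounded_op R \<and> 0 \<le> K \<and> (\<forall>f\<in>ell2. R (pencil c z f) = f \<and> pencil c z (R f) = f \<and>
    ell2_norm (R f) \<le> K * ell2_norm f)"
    using resolvent_exists[OF z] by (elim exE)
  then have R: "bounded_op R" "0 \<le> K"
    and R': "\<And>f. f \<in> ell2 \<Longrightarrow> pencil c z (R f) = f"
    "\<And>f. f \<in> ell2 \<Longrightarrow> ell2_norm (R f) \<le> K * ell2_norm f"
    by simp_all
  define B where "B = K * ell2_norm g"
  obtain m where m: "\<And>M n. \<bar>n\<bar> \<le> int M \<Longrightarrow> c (n + m M) = b n"
    using pseudo_ergodic_window[OF c b] by metis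
  define u where "u M = (\<lambda>n. R (\<lambda>k. g (k - m M)) (n + m M))" for M
  have u: "u M \<in> ell2 \<and> ell2_norm (u M) \<le> B \<and> pencil (\<lambda>n. c (n + m M)) z (u M) = g" for M
  proof -
    have gm: "(\<lambda>k. g (k - m M)) \<in> ell2" using ell2_shift[of g "- m M"] g by simp
    then have "R (\<lambda>k. g (k - m M)) \<in> ell2" using R(1) by (simp add: bounded_op_def)
    then have 1: "u M \<in> ell2" unfolding u_def by (simp add: ell2_shift)
    have 2: "ell2_norm (u M) \<le> B"
      using R'(2)[OF gm] ell2_norm_shift[of g "- m M"] unfolding u_def B_def by (simp add: ell2_norm_shift)
    have 3: "pencil (\<lambda>n. c (n + m M)) z (u M) = g"
      unfolding u_def pencil_translate R'(1)[OF gm] by simp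
    from 1 2 3 show ?thesis by simp
  qed
  have bd: "cmod (u M n) \<le> B" for M n
    using cmod_le_ell2_norm[of "u M" n] u[of M] by linarith
  have "\<exists>k :: nat \<Rightarrow> nat. strict_mono k \<and> (\<forall>n. \<exists>l. (\<lambda>M. u (k M) n) \<longlonglongrightarrow> l)"
  proof (rule function_convergent_subsequence[of "UNIV :: int set" u B])
    fix k :: "nat \<Rightarrow> nat"
    assume "strict_mono k" "\<And>n. n \<in> UNIV \<Longrightarrow> \<exists>l. (\<lambda>M. u (k M) n) \<longlonglongrightarrow> l"
    then show "\<exists>k :: nat \<Rightarrow> nat. strict_mono k \<and> (\<forall>n. \<exists>l. (\<lambda>M. u (k M) n) \<longlonglongrightarrow> l)"
      by (intro exI[of _ k]) simp
  qed (simp_all add: bd)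
  then obtain k :: "nat \<Rightarrow> nat" where k: "strict_mono k" "\<forall>n. \<exists>l. (\<lambda>M. u (k M) n) \<longlonglongrightarrow> l"
    by auto
  from choice[OF k(2)] obtain f where f: "\<And>n. (\<lambda>M. u (k M) n) \<longlonglongrightarrow> f n" by auto
  have "L2_set (\<lambda>n. cmod (f n)) F \<le> B" if "finite F" for F
  proof (rule LIMSEQ_le_const2)
    show "(\<lambda>M. L2_set (\<lambda>n. cmod (u (k M) n)) F) \<longlonglongrightarrow> L2_set (\<lambda>n. cmod (f n)) F"
      unfolding L2_set_def by (intro tendsto_intros f)
    show "\<exists>N. \<forall>M\<ge>N. L2_set (\<lambda>n. cmod (u (k M) n)) F \<le> B"
      using L2_set_le_ell2_norm[OF _ that] u by (meson order_trans)
  qed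
  then have "f \<in> ell2" by (rule ell2_boundedI(1))
  moreover have "pencil b z f n = g n" for n
  proof (rule LIMSEQ_unique)
    show "(\<lambda>M. pencil b z (u (k M)) n) \<longlonglongrightarrow> pencil b z f n"
      unfolding pencil_def A_op_def by (intro tendsto_intros f)
    have "pencil b z (u (k M)) n = g n" if "nat \<bar>n\<bar> \<le> M" for M
    proof -
      have "\<bar>n\<bar> \<le> int (k M)" using that seq_suble[OF k(1), of M] by linarith
      then have "pencil b z (u (k M)) n = pencil (\<lambda>n. c (n + m (k M))) z (u (k M)) n"
        by (simp add: pencil_def A_op_def m)
      then show ?thesis using u by simp
    qed
    then show "(\<lambda>M. pencil b z (u (k M)) n) \<longlonglongrightarrow> g n"
      by (intro tendsto_eventually eventually_sequentiallyI)
  qed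
  ultimately show ?thesis by (intro bexI[of _ f] ext)
qed

lemma Spec_subset_pseudo_ergodic:
  assumes c: "pseudo_ergodic \<sigma> c" and b: "b \<in> Omega \<sigma>"
  shows "Spec (A_op b) \<subseteq> Spec (A_op c)"
proof (rule subsetI, rule ccontr)
  fix z assume zb: "z \<in> Spec (A_op b)" and z: "z \<notin> Spec (A_op c)"
  obtain K where K: "0 \<le> K" "\<And>f. f \<in> ell2 \<Longrightarrow> ell2_norm f \<le> K * ell2_norm (pencil b z f)"
    using uniform_lower_bound[OF c z] b by auto
  have inj: "f = h" if "f \<in> ell2" "h \<in> ell2" "pencil b z f = pencil b z h" for f h
  proof -
    have d: "(\<lambda>n. f n - h n) \<in> ell2" using that by (intro ell2_diff)
    have "ell2_norm (\<lambda>n. f n - h n) \<le> 0"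
      using K(2)[OF d] that(3) by (simp add: pencil_diff ell2_norm_def)
    then have "cmod (f n - h n) \<le> 0" for n using cmod_le_ell2_norm[OF d, of n] by linarith
    then show ?thesis by (auto simp: fun_eq_iff)
  qed
  define R where "R g = (SOME f. f \<in> ell2 \<and> pencil b z f = g)" for g
  have R: "R g \<in> ell2" "pencil b z (R g) = g" if "g \<in> ell2" for g
  proof -
    have "\<exists>f. f \<in> ell2 \<and> pencil b z f = g" using pencil_solvable[OF c z b that] by auto
    then have "R g \<in> ell2 \<and> pencil b z (R g) = g" unfolding R_def by (rule someI_ex)
    then show "R g \<in> ell2" "pencil b z (R g) = g" by simp_all
  qed
  have Rp: "R (pencil b z f) = f" if "f \<in> ell2" for f
  proof (rule inj)
    note p = pencil_ell2[OF b that, of z]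
    show "R (pencil b z f) \<in> ell2" "pencil b z (R (pencil b z f)) = pencil b z f"
      by (rule R[OF p])+
  qed (rule that)
  have "bounded_op R"
    unfolding bounded_op_def
  proof (intro conjI ballI allI)
    fix f g assume fg: "f \<in> ell2" "g \<in> ell2"
    show "R (\<lambda>n. f n + g n) = (\<lambda>n. R f n + R g n)"
      by (rule inj) (simp_all add: fg R ell2_add pencil_add)
  next
    fix a f assume f: "f \<in> ell2"
    show "R (\<lambda>n. a * f n) = (\<lambda>n. a * R f n)"
      by (rule inj) (simp_all add: f R ell2_scale pencil_scale)
  next
    show "\<exists>K. \<forall>f\<in>ell2. ell2_norm (R f) \<le> K * ell2_norm f"
    proof (intro exI ballI)
      fix f assume f: "f \<in> ell2"
      show "ell2_norm (R f) \<le> K * ell2_norm f" using K(2)[OF R(1)[OF f]] R(2)[OF f] by simp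
    qed
  qed (rule R)
  moreover have "\<forall>f\<in>ell2. R (pencil b z f) = f \<and> pencil b z (R f) = f" using R Rp by simp
  ultimately have "z \<notin> Spec (A_op b)" unfolding Spec_def mem_Collect_eq not_not pencil_def
    by (intro exI[of _ R] conjI)
  with zb show False by simp
qed

text \<open>The binary digits of \<open>j\<close> are written into the block of sites from \<open>2 ^ j\<close> to
  \<open>2 ^ (j + 1) - 1\<close>. As \<open>j\<close> varies, every finite word appears at the start of some block.\<close>

lemma pseudo_ergodic_exists: "\<exists>c. pseudo_ergodic \<sigma> c"
proof -
  define c where "c n = (if \<exists>j r. n = 2 ^ j + int r \<and> r < 2 ^ j \<and> bit j r then \<sigma> else - \<sigma>)" for n :: int
  have c_block: "c (2 ^ j + int r) = (if bit j r then \<sigma> else - \<sigma>)" if "r < 2 ^ j" for j r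
  proof -
    have "j = j' \<and> r = r'" if eq: "2 ^ j + int r = 2 ^ j' + int r'" and r': "r' < 2 ^ j'" for j' r'
    proof -
      have "int (2 ^ j + r) = int (2 ^ j' + r')" using eq by simp
      then have eq': "2 ^ j + r = 2 ^ j' + r'" by (simp only: of_nat_eq_iff)
      have "floor_log (2 ^ j + r) = j"
        by (rule floor_log_eqI) (use \<open>r < 2 ^ j\<close> in simp_all)
      moreover have "floor_log (2 ^ j' + r') = j'"
        by (rule floor_log_eqI) (use r' in simp_all)
      ultimately have "j = j'" by (simp add: eq')
      with eq' show ?thesis by simp
    qed
    then have "(\<exists>j' r'. 2 ^ j + int r = 2 ^ j' + int r' \<and> r' < 2 ^ j' \<and> bit j' r') \<longleftrightarrow> bit j r"
      using that by auto
    then show ?thesis by (simp only: c_def)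
  qed
  have "pseudo_ergodic \<sigma> c"
    unfolding pseudo_ergodic_def
  proof (intro conjI allI impI)
    show "c \<in> Omega \<sigma>" by (simp add: Omega_def c_def)
    fix N and b :: "nat \<Rightarrow> real" assume b: "\<forall>r\<in>{1..N}. b r \<in> {\<sigma>, - \<sigma>}"
    \<comment> \<open>The extra leading digit makes \<open>j\<close> at least \<open>2 ^ N\<close>, so that the word fits into its block.\<close>
    define bs where "bs = map (\<lambda>r. b (Suc r) = \<sigma>) [0..<N] @ [True]"
    define j :: nat where "j = horner_sum of_bool 2 bs"
    have bj: "bit j r \<longleftrightarrow> r < length bs \<and> bs ! r" for r
      by (simp add: j_def bit_horner_sum_bit_iff)
    have "bit j N" by (simp add: bj bs_def nth_append)
    then have "\<not> j < 2 ^ N" by (auto simp: bit_iff_odd)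
    then have "N < 2 ^ j" using less_exp[of N] less_exp[of j] by linarith
    have "b r = c (2 ^ j - 1 + int r)" if "r \<in> {1..N}" for r
    proof -
      define q where "q = r - 1"
      have q: "r = Suc q" "q < N" using that by (auto simp: q_def)
      have "c (2 ^ j + int q) = (if bit j q then \<sigma> else - \<sigma>)"
        using q \<open>N < 2 ^ j\<close> by (intro c_block) simp
      moreover have "bit j q \<longleftrightarrow> b r = \<sigma>" using q by (simp add: bj bs_def nth_append)
      ultimately show ?thesis using b that q by auto
    qed
    then show "\<exists>m. \<forall>r\<in>{1..N}. b r = c (m + int r)" by blast
  qed
  then show ?thesis by blast
qed

lemma S_set_eq:
  assumes "pseudo_ergodic \<sigma> c"
  shows "S_set \<sigma> = Spec (A_op c)"
  unfolding S_set_def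
proof (rule the_equality)
  have "Spec (A_op d) = Spec (A_op c)" if "pseudo_ergodic \<sigma> d" for d
    using Spec_subset_pseudo_ergodic that assms by (metis pseudo_ergodic_def subset_antisym)
  then show "\<forall>d. pseudo_ergodic \<sigma> d \<longrightarrow> Spec (A_op d) = Spec (A_op c)" by blast
qed (use assms in blast)

section \<open>Half-line sequences for which every solution decays\<close>

text \<open>Decay is demanded for all initial values, so that whatever arrives from the left half-line can
  be continued. The coefficient that links \<open>f n\<close> to the site \<open>n + 1\<close> is indexed by \<open>n\<close>, one less than
  in \<^const>\<open>A_op\<close>.\<close>

definition half_line_stable :: "real \<Rightarrow> complex \<Rightarrow> bool" where
  "half_line_stable s z \<longleftrightarrow> (\<exists>c :: nat \<Rightarrow> real. (\<forall>n. c n \<in> {s, - s}) \<and>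
     (\<forall>f. (\<forall>n. f (n + 2) = z * f (n + 1) - of_real (c n) * f n) \<longrightarrow> summable (\<lambda>n. (cmod (f n))\<^sup>2)))"

lemma half_line_stable_small:
  assumes s: "0 < s" and zs: "cmod z + s < 1"
  shows "half_line_stable s z"
proof -
  \<comment> \<open>Since \<open>q \<le> 1\<close>, this \<open>q\<close> satisfies \<open>cmod z * q + s \<le> q\<^sup>2\<close>, as the rate of a geometric bound must.\<close>
  define q where "q = sqrt (cmod z + s)"
  have q2: "q\<^sup>2 = cmod z + s" using s by (simp add: q_def)
  have q: "0 < q" "q < 1" using s zs by (auto simp: q_def add_nonneg_pos)
  have "summable (\<lambda>n. (cmod (f n))\<^sup>2)"
    if f: "\<And>n. f (n + 2) = z * f (n + 1) - of_real s * f n" for f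
  proof -
    define C where "C = max (cmod (f 0)) (cmod (f 1) / q)"
    have C: "0 \<le> C" "cmod (f 0) \<le> C" "cmod (f 1) \<le> C * q"
      using q by (auto simp: C_def max_def field_simps)
    have b: "cmod (f n) \<le> C * q ^ n \<and> cmod (f (n + 1)) \<le> C * q ^ (n + 1)" for n
    proof (induction n)
      case 0 then show ?case using C by simp
    next
      case (Suc n)
      have "cmod (f (n + 2)) \<le> cmod z * cmod (f (n + 1)) + s * cmod (f n)"
        unfolding f using norm_triangle_ineq4[of "z * f (n + 1)" "of_real s * f n"] s
        by (simp add: norm_mult)
      also have "\<dots> \<le> cmod z * (C * q ^ n) + s * (C * q ^ n)"
      proof (intro add_mono mult_left_mono)
        have "C * q ^ (n + 1) \<le> C * q ^ n"
          using C(1) q by (intro mult_left_mono power_decreasing) auto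
        then show "cmod (f (n + 1)) \<le> C * q ^ n" using Suc by linarith
      qed (use Suc s in auto)
      also have "\<dots> = C * q ^ n * q\<^sup>2" unfolding q2 by (simp add: algebra_simps)
      also have "\<dots> = C * q ^ (n + 2)" by (simp add: power_add power2_eq_square)
      finally show ?case using Suc by simp
    qed
    have "summable (\<lambda>n. C\<^sup>2 * (q\<^sup>2) ^ n)"
      using q by (intro summable_mult summable_geometric) (auto simp: power_less_one_iff abs_square_less_1)
    then show ?thesis
    proof (rule summable_comparison_test')
      show "norm ((cmod (f n))\<^sup>2) \<le> C\<^sup>2 * (q\<^sup>2) ^ n" for n
        using power_mono[of "cmod (f n)" "C * q ^ n" 2] b[of n]
        by (simp add: power_mult_distrib power_mult[symmetric] mult.commute)
    qed
  qed
  then show ?thesis unfolding half_line_stable_def by (intro exI[of _ "\<lambda>_. s"]) auto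
qed

text \<open>For coefficients \<open>d 0, - d 1, d 1, - d 2, d 2, \<dots>\<close>, substituting the recurrence into itself
  at an even site cancels the diagonal terms and leaves the recurrence for \<open>z\<^sup>2\<close> with coefficients
  \<open>- d (Suc n) * d n\<close>. Any sequence \<open>b\<close> with values in \<open>{s\<^sup>2, - s\<^sup>2}\<close> is of this form. So
  the even sites decay, and as \<open>z \<noteq> 0\<close> they control the odd ones.\<close>

lemma half_line_stable_sqrt:
  assumes s: "0 < s" and z: "z \<noteq> 0" and st: "half_line_stable (s\<^sup>2) (z\<^sup>2)"
  shows "half_line_stable s z"
proof -
  obtain b where b: "\<And>n. b n \<in> {s\<^sup>2, - s\<^sup>2}"
    and bs: "\<And>f. (\<And>n. f (n + 2) = z\<^sup>2 * f (n + 1) - of_real (b n) * f n) \<Longrightarrow> summable (\<lambda>n. (cmod (f n))\<^sup>2)"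
    using st unfolding half_line_stable_def by blast
  define d where "d = rec_nat s (\<lambda>n x. - b n / x)"
  have d_Suc: "d (Suc n) = - b n / d n" for n by (simp add: d_def)
  have d: "d n \<in> {s, - s}" for n
  proof (induction n)
    case (Suc n)
    then show ?case using b[of n] s by (auto simp: d_Suc power2_eq_square)
  qed (simp add: d_def)
  have bd: "b n = - d (Suc n) * d n" for n using d[of n] s by (auto simp: d_Suc)
  define c where "c n = (if even n then d (n div 2) else - d (Suc (n div 2)))" for n
  have "summable (\<lambda>n. (cmod (f n))\<^sup>2)"
    if f: "\<And>n. f (n + 2) = z * f (n + 1) - of_real (c n) * f n" for f
  proof -
    have f0: "f (2 * n + 2) = z * f (2 * n + 1) - of_real (d n) * f (2 * n)" for n
      using f[of "2 * n"] by (simp add: c_def)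
    have f1: "f (2 * n + 3) = z * f (2 * n + 2) + of_real (d (Suc n)) * f (2 * n + 1)" for n
      using f[of "2 * n + 1"] by (simp add: c_def numeral_3_eq_3)
    have f2: "f (2 * n + 4) = z * f (2 * n + 3) - of_real (d (Suc n)) * f (2 * n + 2)" for n
      using f0[of "Suc n"] by (simp add: numeral_eq_Suc)
    have E: "summable (\<lambda>n. (cmod (f (2 * n)))\<^sup>2)"
    proof (rule bs)
      fix n
      have zf: "z * f (2 * n + 1) = f (2 * n + 2) + of_real (d n) * f (2 * n)"
        using f0[of n] by simp
      have "f (2 * n + 4) = z\<^sup>2 * f (2 * n + 2) + of_real (d (Suc n)) * (z * f (2 * n + 1))
          - of_real (d (Suc n)) * f (2 * n + 2)"
        unfolding f2 f1 by (simp add: algebra_simps power2_eq_square)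
      also have "\<dots> = z\<^sup>2 * f (2 * n + 2) - of_real (b n) * f (2 * n)"
        unfolding zf bd by (simp add: algebra_simps)
      finally show "f (2 * (n + 2)) = z\<^sup>2 * f (2 * (n + 1)) - of_real (b n) * f (2 * n)"
        by (simp only: add_mult_distrib2) simp
    qed
    have E': "summable (\<lambda>n. (cmod (f (2 * n + 2)))\<^sup>2)"
      using summable_ignore_initial_segment[OF E, of 1] by (simp add: algebra_simps)
    have O: "summable (\<lambda>n. (cmod (f (2 * n + 1)))\<^sup>2)"
    proof (rule summable_comparison_test')
      show "summable (\<lambda>n. (2 / (cmod z)\<^sup>2) * ((cmod (f (2 * n + 2)))\<^sup>2 + s\<^sup>2 * (cmod (f (2 * n)))\<^sup>2))"
        by (intro summable_mult summable_add E E')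
      fix n
      have "z * f (2 * n + 1) = f (2 * n + 2) + of_real (d n) * f (2 * n)"
        using f0[of n] by simp
      then have "cmod z * cmod (f (2 * n + 1)) \<le> cmod (f (2 * n + 2)) + cmod (of_real (d n) * f (2 * n))"
        by (metis norm_mult norm_triangle_ineq)
      also have "cmod (of_real (d n) * f (2 * n)) = s * cmod (f (2 * n))"
        using d[of n] s by (auto simp: norm_mult)
      finally have "(cmod z * cmod (f (2 * n + 1)))\<^sup>2 \<le> (cmod (f (2 * n + 2)) + s * cmod (f (2 * n)))\<^sup>2"
        by (intro power_mono) auto
      also have "\<dots> \<le> 2 * ((cmod (f (2 * n + 2)))\<^sup>2 + s\<^sup>2 * (cmod (f (2 * n)))\<^sup>2)"
        using sum_squares_bound[of "cmod (f (2 * n + 2))" "s * cmod (f (2 * n))"]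
        by (simp add: power2_sum power_mult_distrib)
      finally show "norm ((cmod (f (2 * n + 1)))\<^sup>2) \<le>
          (2 / (cmod z)\<^sup>2) * ((cmod (f (2 * n + 2)))\<^sup>2 + s\<^sup>2 * (cmod (f (2 * n)))\<^sup>2)"
        using z by (simp add: power_mult_distrib field_simps)
    qed
    from E O obtain x y where "(\<lambda>n. (cmod (f (2 * n)))\<^sup>2) sums x" "(\<lambda>n. (cmod (f (2 * n + 1)))\<^sup>2) sums y"
      by (auto simp: summable_def)
    from sums_if[OF this(2,1)]
    have "(\<lambda>n. if even n then (cmod (f (2 * (n div 2))))\<^sup>2 else (cmod (f (2 * ((n - 1) div 2) + 1)))\<^sup>2) sums (y + x)" .
    also have "(\<lambda>n. if even n then (cmod (f (2 * (n div 2))))\<^sup>2 else (cmod (f (2 * ((n - 1) div 2) + 1)))\<^sup>2)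
      = (\<lambda>n. (cmod (f n))\<^sup>2)"
      by (auto simp: fun_eq_iff elim!: oddE)
    finally show ?thesis by (auto simp: summable_def)
  qed
  moreover have "c n \<in> {s, - s}" for n using d[of "n div 2"] d[of "Suc (n div 2)"] by (auto simp: c_def)
  ultimately show ?thesis unfolding half_line_stable_def by blast
qed

lemma half_line_stable_disc:
  assumes s: "0 < s" "s < 1" and z: "z \<noteq> 0" "cmod z < 1"
  shows "half_line_stable s z"
proof -
  have "half_line_stable s z" if "0 < s" "z \<noteq> 0" "cmod z ^ (2 ^ k) + s ^ (2 ^ k) < 1" for k s z
    using that
  proof (induction k arbitrary: s z)
    case 0 then show ?case using half_line_stable_small by simp
  next
    case (Suc k)
    have "half_line_stable (s\<^sup>2) (z\<^sup>2)"
      using Suc.prems by (intro Suc.IH) (auto simp: norm_power power_mult)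
    then show ?case using half_line_stable_sqrt Suc.prems by blast
  qed
  moreover have "\<exists>k :: nat. cmod z ^ (2 ^ k) + s ^ (2 ^ k) < 1"
  proof -
    have "(\<lambda>n. cmod z ^ n + s ^ n) \<longlonglongrightarrow> 0 + 0"
      using s z by (intro tendsto_add LIMSEQ_power_zero) auto
    then have "\<forall>\<^sub>F n in sequentially. cmod z ^ n + s ^ n < 1"
      by (rule order_tendstoD) simp
    then obtain N where "\<And>n. n \<ge> N \<Longrightarrow> cmod z ^ n + s ^ n < 1"
      by (auto simp: eventually_sequentially)
    moreover have "N \<le> 2 ^ N" using less_exp[of N] by simp
    ultimately show ?thesis by blast
  qed
  ultimately show ?thesis using s z by blast
qed

section \<open>Eigenvectors outside one of the ellipses\<close>

definition ellipse_form :: "real \<Rightarrow> complex \<Rightarrow> real" where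
  "ellipse_form s z = (Re z)\<^sup>2 / (1 + s)\<^sup>2 + (Im z)\<^sup>2 / (1 - s)\<^sup>2"

text \<open>The map \<open>z \<mapsto> z + s / z\<close> sends the circle of radius \<open>r\<close> to an ellipse with semi-axes
  \<open>r + s / r\<close> and \<open>r - s / r\<close> (up to sign). The two preimages of \<open>\<mu>\<close> have product \<open>s\<close>, so if both
  lie in the unit disc, then \<open>\<bar>s\<bar> \<le> r \<le> 1\<close>, and for such \<open>r\<close> the semi-axes do not exceed those for
  \<open>r = 1\<close>: the point \<open>\<mu>\<close> is in the closed ellipse.\<close>

lemma expanding_root:
  assumes s: "\<bar>s\<bar> < 1" "s \<noteq> 0" and \<mu>: "1 < ellipse_form s \<mu>"
  shows "\<exists>z. 1 < cmod z \<and> \<mu> = z + of_real s / z"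
proof -
  define w where "w = csqrt (\<mu>\<^sup>2 - 4 * of_real s)"
  define z where "z = (\<mu> + w) / 2"
  define z' where "z' = (\<mu> - w) / 2"
  have w2: "w\<^sup>2 = \<mu>\<^sup>2 - 4 * of_real s" by (simp add: w_def)
  have prod: "z * z' = of_real s"
  proof -
    have "z * z' = (\<mu>\<^sup>2 - w\<^sup>2) / 4" by (simp add: z_def z'_def power2_eq_square algebra_simps)
    then show ?thesis by (simp add: w2)
  qed
  have sum: "z + z' = \<mu>" by (simp add: z_def z'_def field_simps)
  have nz: "z \<noteq> 0" "z' \<noteq> 0" using prod s by auto
  have eqs: "\<mu> = z + of_real s / z" "\<mu> = z' + of_real s / z'"
    using sum prod nz by (auto simp: field_simps)
  show ?thesis
  proof (rule ccontr)
    assume no: "\<not> ?thesis"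
    have "cmod x \<le> 1" if x: "\<mu> = x + of_real s / x" for x
    proof (rule ccontr)
      assume "\<not> cmod x \<le> 1"
      then have "1 < cmod x \<and> \<mu> = x + of_real s / x" using x by (intro conjI) simp
      then have "\<exists>z. 1 < cmod z \<and> \<mu> = z + of_real s / z" by (rule exI)
      with no show False by (rule notE)
    qed
    from this[OF eqs(1)] this[OF eqs(2)] have le: "cmod z \<le> 1" "cmod z' \<le> 1" .
    define r where "r = cmod z"
    have r: "0 < r" "r \<le> 1" "\<bar>s\<bar> \<le> r"
    proof -
      show "0 < r" "r \<le> 1" using nz le by (auto simp: r_def)
      have "\<bar>s\<bar> = r * cmod z'" using prod by (metis norm_mult norm_of_real r_def)
      also have "\<dots> \<le> r * 1" using le by (intro mult_left_mono) (auto simp: r_def)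
      finally show "\<bar>s\<bar> \<le> r" by simp
    qed
    have r2: "(Re z)\<^sup>2 + (Im z)\<^sup>2 = r\<^sup>2" by (simp add: r_def cmod_power2)
    have sz: "of_real s / z = of_real (s / r\<^sup>2) * cnj z"
      using nz by (simp add: r_def complex_div_cnj[of _ z] cmod_power2)
    have Re: "Re \<mu> = (r + s / r) * (Re z / r)" and Im: "Im \<mu> = (r - s / r) * (Im z / r)"
      using r unfolding eqs(1) sz by (auto simp: field_simps power2_eq_square)
    have bound: "\<bar>r + t / r\<bar> \<le> 1 + t" if t: "\<bar>t\<bar> \<le> r" for t
    proof -
      define u where "u = t / r"
      have u: "\<bar>u\<bar> \<le> 1" "r * u = t" using r t by (simp_all add: u_def abs_divide)
      have "0 \<le> (1 - r) * (1 - u)" "0 \<le> (1 + r) * (1 + u)"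
        using r u by (intro mult_nonneg_nonneg; linarith)+
      then have "\<bar>r + u\<bar> \<le> 1 + r * u" by (simp add: abs_le_iff algebra_simps)
      then show ?thesis by (simp only: u(2)) (simp only: u_def)
    qed
    have A: "(r + s / r)\<^sup>2 \<le> (1 + s)\<^sup>2" "(r - s / r)\<^sup>2 \<le> (1 - s)\<^sup>2"
      using bound[of s] bound[of "- s"] r s by (auto simp: abs_le_square_iff[symmetric])
    have "ellipse_form s \<mu> = (r + s / r)\<^sup>2 / (1 + s)\<^sup>2 * (Re z / r)\<^sup>2 + (r - s / r)\<^sup>2 / (1 - s)\<^sup>2 * (Im z / r)\<^sup>2"
      unfolding ellipse_form_def Re Im power_mult_distrib by (simp only: times_divide_eq_left)
    also have "\<dots> \<le> 1 * (Re z / r)\<^sup>2 + 1 * (Im z / r)\<^sup>2"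
      using A s by (intro add_mono mult_right_mono) (auto simp: divide_le_eq_1)
    also have "\<dots> = 1" using r r2 by (simp add: power_divide add_divide_distrib[symmetric])
    finally show False using \<mu> by simp
  qed
qed

text \<open>The decaying powers of the expanding root on the left half-line are continued by a solution for
  the stable coefficients on the right.\<close>

lemma eigenvector:
  assumes \<sigma>: "0 < \<sigma>" "\<sigma> < 1" and s: "s \<in> {\<sigma>, - \<sigma>}" and \<mu>: "cmod \<mu> < 1" "1 < ellipse_form s \<mu>"
  shows "\<exists>b\<in>Omega \<sigma>. \<exists>f\<in>ell2. f 0 = 1 \<and> A_op b f = (\<lambda>n. \<mu> * f n)"
proof -
  obtain z where z: "1 < cmod z" "\<mu> = z + of_real s / z"
    using expanding_root[of s \<mu>] \<sigma> s \<mu> by auto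
  have z0: "z \<noteq> 0" using z by auto
  have "\<mu> \<noteq> 0" using \<mu>(2) by (auto simp: ellipse_form_def)
  then obtain c where c: "\<And>n. c n \<in> {\<sigma>, - \<sigma>}"
    and cs: "\<And>f. (\<And>n. f (n + 2) = \<mu> * f (n + 1) - of_real (c n) * f n) \<Longrightarrow> summable (\<lambda>n. (cmod (f n))\<^sup>2)"
    using half_line_stable_disc[OF \<sigma> _ \<mu>(1)] unfolding half_line_stable_def by blast
  \<comment> \<open>The solution on the right that continues the powers of \<open>z\<close> across the sites 0 and 1.\<close>
  define p where "p = rec_nat (1, z) (\<lambda>n (x, y). (y, \<mu> * y - of_real (c n) * x))"
  define h where "h n = fst (p n)" for n
  have p_Suc: "p (Suc n) = (snd (p n), \<mu> * snd (p n) - of_real (c n) * fst (p n))" for n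
    by (simp add: p_def split: prod.split)
  have h: "h 0 = 1" "h 1 = z" "\<And>n. h (n + 2) = \<mu> * h (n + 1) - of_real (c n) * h n"
    by (simp_all add: h_def p_Suc) (simp_all add: p_def)
  define f where "f k = (if k \<le> 0 then z powi k else h (nat k))" for k :: int
  define b where "b k = (if k \<le> 0 then s else c (nat k - 1))" for k :: int
  have fh: "f (int n) = h n" for n by (auto simp: f_def h(1))
  have fz: "f k = z powi k" if "k \<le> 1" for k
    using that h by (cases "k = 1") (auto simp: f_def)
  have "(\<lambda>k. (cmod (f k))\<^sup>2) summable_on {0..}"
  proof -
    have "(\<lambda>n. (cmod (f (int n)))\<^sup>2) summable_on UNIV"
      using cs[OF h(3)] by (simp add: fh summable_on_UNIV_nonneg_real_iff)
    moreover have bij: "bij_betw int UNIV {0..}" by (rule bij_betwI[of _ _ _ nat]) auto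
    ultimately show ?thesis
      using summable_on_reindex_bij_betw[OF bij, of "\<lambda>k. (cmod (f k))\<^sup>2"] by simp
  qed
  moreover have "(\<lambda>k. (cmod (f k))\<^sup>2) summable_on {..<0}"
  proof -
    have "1 < (cmod z)\<^sup>2" using z(1) by (simp add: one_less_power)
    then have "summable (\<lambda>n. (1 / (cmod z)\<^sup>2) ^ n)" 
      using z0 by (intro summable_geometric) (simp add: divide_less_eq_1)
    then have "summable (\<lambda>n. (1 / (cmod z)\<^sup>2) ^ Suc n)" by (subst summable_Suc_iff)
    moreover have "(cmod (f (- int (Suc n))))\<^sup>2 = (1 / (cmod z)\<^sup>2) ^ Suc n" for n
    proof -
      have "cmod (f (- int m)) = inverse (cmod z ^ m)" for m
        by (subst fz) (simp_all add: power_int_minus norm_inverse norm_power)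
      moreover have "(inverse (x ^ m))\<^sup>2 = (1 / x\<^sup>2) ^ m" for x :: real and m
        by (simp add: power_one_over inverse_eq_divide power_divide mult.commute flip: power_mult)
      ultimately show ?thesis by (simp only:)
    qed
    ultimately have "(\<lambda>n. (cmod (f (- int (Suc n))))\<^sup>2) summable_on UNIV"
      by (subst summable_on_UNIV_nonneg_real_iff) simp_all
    moreover have bij: "bij_betw (\<lambda>n. - int (Suc n)) UNIV {..<0}"
      by (rule bij_betwI[of _ _ _ "\<lambda>k. nat (- k) - 1"]) auto
    ultimately show ?thesis
      using summable_on_reindex_bij_betw[OF bij, of "\<lambda>k. (cmod (f k))\<^sup>2"] by simp
  qed
  ultimately have "(\<lambda>k. (cmod (f k))\<^sup>2) summable_on ({0..} \<union> {..<0})"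
    by (rule summable_on_Un_disjoint) auto
  moreover have "{0..} \<union> {..<0} = (UNIV :: int set)" by auto
  ultimately have "f \<in> ell2" by (simp add: ell2_def)
  moreover have "b \<in> Omega \<sigma>" using c s by (auto simp: Omega_def b_def)
  moreover have "f 0 = 1" by (simp add: f_def)
  moreover have "A_op b f k = \<mu> * f k" for k
  proof (cases "k \<le> 0")
    case True
    have "z powi (k - 1) = z powi k / z" "z powi (k + 1) = z powi k * z"
      using z0 by (simp_all add: power_int_diff power_int_add)
    with True z0 show ?thesis by (simp add: A_op_def b_def fz z(2) field_simps)
  next
    case False
    define n where "n = nat k - 1"
    have k: "k = int n + 1" using False by (simp add: n_def)
    have "f (k - 1) = h n" "f k = h (n + 1)" "f (k + 1) = h (n + 2)"
      using fh[of n] fh[of "n + 1"] fh[of "n + 2"] by (simp_all add: k algebra_simps)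
    moreover have "b k = c n" using False by (simp add: b_def n_def)
    ultimately show ?thesis using h(3)[of n] by (simp add: A_op_def)
  qed
  ultimately show ?thesis by (auto simp: fun_eq_iff)
qed

section \<open>The disc outside the hole\<close>

lemma ellipse_form_scale: "ellipse_form s (of_real t * z) = t\<^sup>2 * ellipse_form s z"
  by (simp add: ellipse_form_def power_mult_distrib algebra_simps)

text \<open>On the unit circle the two forms have a constant sum, which exceeds two.\<close>

lemma unit_circle_outside_ellipse:
  assumes s: "0 < s" "s < 1" and z: "cmod z = 1"
  shows "1 < ellipse_form s z \<or> 1 < ellipse_form (- s) z"
proof -
  have zz: "(Re z)\<^sup>2 + (Im z)\<^sup>2 = 1" using z cmod_power2[of z] by simp
  have "ellipse_form s z + ellipse_form (- s) z = ((Re z)\<^sup>2 + (Im z)\<^sup>2) * (1 / (1 + s)\<^sup>2 + 1 / (1 - s)\<^sup>2)"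
    by (simp add: ellipse_form_def algebra_simps)
  also have "\<dots> = 1 / (1 + s)\<^sup>2 + 1 / (1 - s)\<^sup>2" by (simp add: zz)
  also have "\<dots> > 2"
  proof -
    define a where "a = 1 / (1 + s)"
    define b where "b = 1 / (1 - s)"
    have s2: "0 < s\<^sup>2" "s\<^sup>2 < 1" using s by (auto simp: abs_square_less_1)
    have "2 < 2 / (1 - s\<^sup>2)" using s2 by (simp add: field_simps)
    also have "1 - s\<^sup>2 = (1 + s) * (1 - s)" by (simp add: algebra_simps power2_eq_square)
    also have "2 / ((1 + s) * (1 - s)) = a + b" using s by (simp add: a_def b_def add_frac_eq)
    finally have "2\<^sup>2 < (a + b)\<^sup>2" by (intro power_strict_mono) auto
    moreover have "(a + b)\<^sup>2 \<le> 2 * (a\<^sup>2 + b\<^sup>2)"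
      using sum_squares_bound[of a b] by (simp add: power2_sum)
    ultimately show ?thesis by (simp add: a_def b_def power_divide)
  qed
  finally show ?thesis by linarith
qed

text \<open>Moving along the ray through \<open>z\<close> suffices: a point of the open disc outside the hole is pushed
  outwards, which makes its ellipse inequality strict; a point of the unit circle already satisfies
  one of the inequalities strictly and is pushed inwards.\<close>

lemma approximation_outside_ellipse:
  assumes \<sigma>: "0 < \<sigma>" "\<sigma> < 1" and z: "cmod z \<le> 1" "z \<notin> H_set \<sigma>" and e: "0 < e"
  shows "\<exists>s\<in>{\<sigma>, - \<sigma>}. \<exists>\<mu>. cmod (\<mu> - z) < e \<and> cmod \<mu> < 1 \<and> 1 < ellipse_form s \<mu>"
proof -
  have near: "\<forall>\<^sub>F t in F. cmod (of_real t * z - z) < e" if "((\<lambda>t::real. t) \<longlongrightarrow> 1) F" for F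
  proof -
    have "((\<lambda>t. cmod (of_real t * z - z)) \<longlongrightarrow> cmod (of_real 1 * z - z)) F"
      by (intro tendsto_intros that)
    then show ?thesis by (rule order_tendstoD) (use e in simp)
  qed
  show ?thesis
  proof (cases "cmod z = 1")
    case True
    then obtain s where s: "s \<in> {\<sigma>, - \<sigma>}" "1 < ellipse_form s z"
      using unit_circle_outside_ellipse[OF \<sigma>] by blast
    have "((\<lambda>t. t\<^sup>2 * ellipse_form s z) \<longlongrightarrow> 1\<^sup>2 * ellipse_form s z) (at_left 1)"
      by (intro tendsto_intros)
    then have "\<forall>\<^sub>F t in at_left 1. 1 < t\<^sup>2 * ellipse_form s z"
      by (rule order_tendstoD) (use s in simp)
    moreover have "\<forall>\<^sub>F t::real in at_left 1. 0 < t \<and> t < 1"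
      by (auto simp: eventually_at_left[of 0] intro!: exI[of _ 0])
    moreover have "\<forall>\<^sub>F t in at_left 1. cmod (of_real t * z - z) < e" by (intro near tendsto_ident_at)
    ultimately have "\<forall>\<^sub>F t in at_left 1. cmod (of_real t * z - z) < e \<and> cmod (of_real t * z) < 1 \<and> 1 < ellipse_form s (of_real t * z)"
      by eventually_elim (simp add: True norm_mult ellipse_form_scale)
    then obtain t :: real where "cmod (of_real t * z - z) < e \<and> cmod (of_real t * z) < 1 \<and> 1 < ellipse_form s (of_real t * z)"
      using eventually_happens'[OF trivial_limit_at_left_real] by blast
    then show ?thesis using s by blast
  next
    case False
    then have z1: "cmod z < 1" using z by simp
    obtain s where s: "s \<in> {\<sigma>, - \<sigma>}" "1 \<le> ellipse_form s z"
      using z(2) by (force simp: H_set_def E_set_def ellipse_form_def)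
    have "((\<lambda>t. cmod (of_real t * z)) \<longlongrightarrow> cmod (of_real 1 * z)) (at_right 1)"
      by (intro tendsto_intros)
    then have "\<forall>\<^sub>F t in at_right 1. cmod (of_real t * z) < 1"
      by (rule order_tendstoD) (use z1 in simp)
    moreover have "\<forall>\<^sub>F t::real in at_right 1. 1 < t" by (rule eventually_at_right_less)
    moreover have "\<forall>\<^sub>F t in at_right 1. cmod (of_real t * z - z) < e" by (intro near tendsto_ident_at)
    ultimately have "\<forall>\<^sub>F t in at_right 1. cmod (of_real t * z - z) < e \<and> cmod (of_real t * z) < 1 \<and> 1 < ellipse_form s (of_real t * z)"
    proof eventually_elim
      case (elim t)
      have "1 < t\<^sup>2" using elim by (simp add: one_less_power)
      then have "1 < t\<^sup>2 * ellipse_form s z" using s(2)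
        by (metis less_le_trans mult.right_neutral mult_left_mono zero_le_power2)
      with elim show ?case by (simp add: ellipse_form_scale)
    qed
    then obtain t :: real where "cmod (of_real t * z - z) < e \<and> cmod (of_real t * z) < 1 \<and> 1 < ellipse_form s (of_real t * z)"
      using eventually_happens'[OF trivial_limit_at_right_real] by blast
    then show ?thesis using s by blast
  qed
qed

theorem theorem27:
  fixes \<sigma> :: real
  assumes "0 < \<sigma>" and "\<sigma> < 1"
  shows "{z :: complex. cmod z \<le> 1} - H_set \<sigma> \<subseteq> S_set \<sigma>"
proof (rule subsetI, rule ccontr)
  fix z assume z: "z \<in> {z. cmod z \<le> 1} - H_set \<sigma>" and nS: "z \<notin> S_set \<sigma>"
  obtain c where c: "pseudo_ergodic \<sigma> c" using pseudo_ergodic_exists by blast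
  have "z \<notin> Spec (A_op c)" using nS S_set_eq[OF c] by simp
  from uniform_lower_bound[OF c this] obtain K where K: "0 \<le> K"
    "\<forall>b\<in>Omega \<sigma>. \<forall>f\<in>ell2. ell2_norm f \<le> K * ell2_norm (pencil b z f)"
    by auto
  obtain s \<mu> where \<mu>: "s \<in> {\<sigma>, - \<sigma>}" "cmod (\<mu> - z) < 1 / (K + 1)" "cmod \<mu> < 1" "1 < ellipse_form s \<mu>"
    using approximation_outside_ellipse[OF assms, of z "1 / (K + 1)"] z K(1) by auto
  obtain b f where bf: "b \<in> Omega \<sigma>" "f \<in> ell2" "f 0 = 1" "A_op b f = (\<lambda>n. \<mu> * f n)"
    using eigenvector[OF assms \<mu>(1,3,4)] by blast
  have "pencil b z f = (\<lambda>n. (\<mu> - z) * f n)" by (simp add: pencil_def bf(4) algebra_simps)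
  then have "ell2_norm (pencil b z f) \<le> cmod (\<mu> - z) * ell2_norm f"
    using ell2_scale(2)[OF bf(2)] by simp
  with K(1) have "K * ell2_norm (pencil b z f) \<le> K * (cmod (\<mu> - z) * ell2_norm f)"
    by (intro mult_left_mono)
  moreover have "ell2_norm f \<le> K * ell2_norm (pencil b z f)" using K(2) bf(1,2) by simp
  ultimately have "ell2_norm f \<le> K * (cmod (\<mu> - z) * ell2_norm f)" by linarith
  moreover have "1 \<le> ell2_norm f" using cmod_le_ell2_norm[OF bf(2), of 0] bf(3) by simp
  ultimately have "1 \<le> K * cmod (\<mu> - z)"
    by (simp add: mult.assoc[symmetric])
  moreover have "K * cmod (\<mu> - z) < 1"
  proof -
    have "(K + 1) * cmod (\<mu> - z) < 1" using \<mu>(2) K(1) by (simp add: field_simps)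
    then have "K * cmod (\<mu> - z) + cmod (\<mu> - z) < 1" by (simp add: algebra_simps)
    then show ?thesis using norm_ge_zero[of "\<mu> - z"] by linarith
  qed
  ultimately show False by simp
qed

end
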